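(* Let $U_1,\dots,U_m\subset\mathbb{R}^n$ be closed convex sets with $S:=\bigcap_{i=1}^mU_i\neq\varnothing$, and let $$T_{\mathrm{MAP}}x:=P_{U_m}P_{U_{m-1}}\cdots P_{U_1}x,\qquad x\in\mathbb{R}^n .$$ Then for all $s\in S$ and all $x\in\mathbb{R}^n$, $$\|T_{\mathrm{MAP}}x-s\|^2\le\|x-s\|^2-\frac1m\,\delta(x)^2 .$$
   Context: $P_{U}$ denotes the metric projection onto the closed convex set $U$ and $\delta(x):=\max_{1\le i\le m}\mathrm{dist}(x,U_i)$; $\|\cdot\|$ is the Euclidean norm. *)

theory Defs
  imports "HOL-Analysis.Analysis"
begin

text \<open>The metric projection is \<open>closest_point\<close> and the distance to a set is \<open>infdist\<close>.
  Families of sets are functions on \<open>nat\<close>, of which only the values at \<open>1, ..., m\<close> matter.\<close>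

primrec T_MAP :: "(nat \<Rightarrow> (real ^ 'n) set) \<Rightarrow> nat \<Rightarrow> real ^ 'n \<Rightarrow> real ^ 'n" where
  "T_MAP U 0 x = x"
| "T_MAP U (Suc k) x = closest_point (U (Suc k)) (T_MAP U k x)"

text \<open>Meaningful only for \<open>m \<ge> 1\<close>, since \<open>Max\<close> of the empty set is unspecified.\<close>

definition delta :: "(nat \<Rightarrow> (real ^ 'n) set) \<Rightarrow> nat \<Rightarrow> real ^ 'n \<Rightarrow> real" where
  "delta U m x = Max ((\<lambda>i. infdist x (U i)) ` {1..m})"

end

theory Submission
  imports Defs
begin

text \<open>Let \<open>x\<^sub>k\<close> be the iterate after \<open>k\<close> projections. As the segment from \<open>x\<^sub>k\<close> to \<open>s\<close> and the segment
  from \<open>x\<^sub>k\<close> to \<open>x\<^bsub>k-1\<^esub>\<close> enclose a non-acute angle at \<open>x\<^sub>k\<close>, each projection lowers the squared distance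
  to \<open>s\<close> by at least the square of its step length (\<open>closest_point_Pythagoras\<close>), so the whole cycle
  lowers it by at least the sum of the squared step lengths (\<open>T_MAP_Fejer\<close>). That sum is large: the
  point \<open>x\<^sub>i\<close> lies in \<open>U i\<close> and is reached from \<open>x\<close> in \<open>i \<le> m\<close> steps, so the triangle inequality and
  the Cauchy--Schwarz inequality bound the squared distance from \<open>x\<close> to \<open>U i\<close> by \<open>m\<close> times the sum
  (\<open>infdist_T_MAP\<close>). The largest of these distances is \<open>delta U m x\<close>.\<close>

text \<open>Pythagoras' theorem with an inequality: by the variational characterization of the projection,
  the two short sides of the triangle meet at a right or obtuse angle (or one of them vanishes).\<close>

lemma closest_point_Pythagoras:
  fixes C :: "'a::euclidean_space set"
  assumes "closed C" "convex C" "s \<in> C"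
  shows "(dist (closest_point C z) s)\<^sup>2 + (dist z (closest_point C z))\<^sup>2 \<le> (dist z s)\<^sup>2"
proof -
  have "(z - closest_point C z) \<bullet> (s - closest_point C z) \<le> 0"
    by (rule closest_point_dot[OF assms(2,1,3)])
  then show ?thesis
    by (simp add: dist_norm power2_norm_eq_inner inner_diff_left inner_diff_right inner_commute)
qed

text \<open>A quantitative form of Fejer monotonicity: the gains of the single projections telescope,
  because \<open>s\<close> belongs to every set that is projected onto.\<close>

lemma T_MAP_Fejer:
  assumes "\<And>i. i \<in> {1..k} \<Longrightarrow> closed (U i)" "\<And>i. i \<in> {1..k} \<Longrightarrow> convex (U i)"
    and "\<And>i. i \<in> {1..k} \<Longrightarrow> s \<in> U i"
  shows "(dist (T_MAP U k x) s)\<^sup>2 + (\<Sum>j<k. (dist (T_MAP U j x) (T_MAP U (Suc j) x))\<^sup>2)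
    \<le> (dist x s)\<^sup>2"
  using assms
proof (induction k)
  case (Suc k)
  have "(dist (T_MAP U (Suc k) x) s)\<^sup>2 + (dist (T_MAP U k x) (T_MAP U (Suc k) x))\<^sup>2
      \<le> (dist (T_MAP U k x) s)\<^sup>2"
    using closest_point_Pythagoras[of "U (Suc k)" s "T_MAP U k x"] Suc.prems by simp
  moreover have "(dist (T_MAP U k x) s)\<^sup>2
      + (\<Sum>j<k. (dist (T_MAP U j x) (T_MAP U (Suc j) x))\<^sup>2) \<le> (dist x s)\<^sup>2"
    using Suc by simp
  ultimately show ?case by simp
qed simp

lemma dist_le_sum_steps:
  fixes f :: "nat \<Rightarrow> 'a::metric_space"
  shows "dist (f 0) (f k) \<le> (\<Sum>j<k. dist (f j) (f (Suc j)))"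
proof (induction k)
  case (Suc k)
  then show ?case using dist_triangle[of "f 0" "f (Suc k)" "f k"] by simp
qed simp

text \<open>Extending the sum from the \<open>i\<close> steps that reach \<open>U i\<close> to all \<open>m\<close> steps makes the bound uniform
  in \<open>i\<close>; the factor \<open>m\<close> is the price of Cauchy--Schwarz for a sum of \<open>m\<close> terms.\<close>

lemma infdist_T_MAP:
  assumes "1 \<le> i" "i \<le> m" "closed (U i)" "U i \<noteq> {}"
  shows "(infdist x (U i))\<^sup>2
    \<le> real m * (\<Sum>j<m. (dist (T_MAP U j x) (T_MAP U (Suc j) x))\<^sup>2)"
proof -
  let ?d = "\<lambda>j. dist (T_MAP U j x) (T_MAP U (Suc j) x)"
  have "T_MAP U i x \<in> U i"
    using assms closest_point_in_set by (cases i) auto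
  then have "infdist x (U i) \<le> dist x (T_MAP U i x)"
    by (rule infdist_le)
  also have "\<dots> \<le> (\<Sum>j<i. ?d j)"
    using dist_le_sum_steps[of "\<lambda>j. T_MAP U j x" i] by simp
  also have "\<dots> \<le> (\<Sum>j<m. ?d j)"
    using assms(2) by (intro sum_mono2) auto
  finally have "(infdist x (U i))\<^sup>2 \<le> (\<Sum>j<m. ?d j)\<^sup>2"
    by (intro power_mono infdist_nonneg)
  also have "\<dots> \<le> real m * (\<Sum>j<m. (?d j)\<^sup>2)"
    using Cauchy_Schwarz_ineq_sum[of "\<lambda>_. 1" ?d "{..<m}"] by simp
  finally show ?thesis .
qed

theorem mainTheorem4:
  fixes U :: "nat \<Rightarrow> (real ^ 'n) set" and m :: nat
  assumes "m \<ge> 1"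
    and "\<And>i. i \<in> {1..m} \<Longrightarrow> closed (U i)"
    and "\<And>i. i \<in> {1..m} \<Longrightarrow> convex (U i)"
    and "(\<Inter>i\<in>{1..m}. U i) \<noteq> {}"
  shows "\<forall>s \<in> (\<Inter>i\<in>{1..m}. U i). \<forall>x :: real ^ 'n.
    (norm (T_MAP U m x - s))\<^sup>2 \<le> (norm (x - s))\<^sup>2 - (1 / real m) * (delta U m x)\<^sup>2"
proof (intro ballI allI)
  fix s x assume s: "s \<in> (\<Inter>i\<in>{1..m}. U i)"
  let ?D = "\<Sum>j<m. (dist (T_MAP U j x) (T_MAP U (Suc j) x))\<^sup>2"
  have "delta U m x \<in> (\<lambda>i. infdist x (U i)) ` {1..m}"
    unfolding delta_def using assms(1) by (intro Max_in) auto
  then obtain i where i: "i \<in> {1..m}" "delta U m x = infdist x (U i)"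
    by blast
  then have "1 \<le> i" "i \<le> m" "closed (U i)" "U i \<noteq> {}"
    using assms(2) s by auto
  then have "(delta U m x)\<^sup>2 \<le> real m * ?D"
    unfolding i(2) by (rule infdist_T_MAP)
  then have "(1 / real m) * (delta U m x)\<^sup>2 \<le> ?D"
    using assms(1) by (simp add: field_simps)
  moreover have "(dist (T_MAP U m x) s)\<^sup>2 + ?D \<le> (dist x s)\<^sup>2"
    using T_MAP_Fejer[of m U s x] assms(2,3) s by auto
  ultimately show "(norm (T_MAP U m x - s))\<^sup>2
      \<le> (norm (x - s))\<^sup>2 - (1 / real m) * (delta U m x)\<^sup>2"
    by (simp add: dist_norm)
qed

end
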